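(* Let $(M,\phi,\xi,\eta,g)$ be a Kenmotsu manifold with a generalized symmetric metric connection $\bar\nabla$ of type $(\alpha,\beta)$, $\alpha\neq-1$, with Ricci tensor $\bar S$ and $W_2$-curvature tensor $\bar W_2$, satisfying $\bar W_2(\xi,X)\cdot\bar S=0$, i.e. $$\bar S(\bar W_2(\xi,X)Y,Z)+\bar S(Y,\bar W_2(\xi,X)Z)=0$$ for all vector fields $X,Y,Z$ on $M$. Then every Ricci soliton $(g,\xi,\lambda)$ on $M$ (with respect to $\bar\nabla$) is either shrinking or expanding.
   Context: An almost contact metric manifold is a smooth manifold $M$ of odd dimension with a $(1,1)$-tensor field $\phi$, a vector field $\xi$, a 1-form $\eta$ and a Riemannian metric $g$ such that $\phi\xi=0$, $\eta(\phi X)=0$, $\eta(\xi)=1$, $\phi^2X=-X+\eta(X)\xi$, $g(\phi X,\phi Y)=g(X,Y)-\eta(X)\eta(Y)$, $g(X,\xi)=\eta(X)$. It is a Kenmotsu manifold if, with $\nabla$ the Levi-Civita connection, $(\nabla_X\phi)Y=g(\phi X,Y)\xi-\eta(Y)\phi X$ and $\nabla_X\xi=X-\eta(X)\xi$. For smooth functions $\alpha,\beta$ on $M$, the generalized symmetric metric connection of type $(\alpha,\beta)$ is the linear connection $\bar\nabla$ with $\bar\nabla g=0$ and torsion $T(X,Y)=\alpha\{\eta(Y)X-\eta(X)Y\}+\beta\{\eta(Y)\phi X-\eta(X)\phi Y\}$; explicitly $\bar\nabla_XY=\nabla_XY+\alpha\{\eta(Y)X-g(X,Y)\xi\}-\beta\eta(X)\phi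 Y$. Its curvature tensor is $\bar R(X,Y)Z=\bar\nabla_X\bar\nabla_YZ-\bar\nabla_Y\bar\nabla_XZ-\bar\nabla_{[X,Y]}Z$, its Ricci tensor is $\bar S(Y,Z)=\operatorname{trace}(X\mapsto\bar R(X,Y)Z)$, and its Ricci operator $\bar Q$ is defined by $g(\bar QX,Y)=\bar S(X,Y)$. The $W_2$-curvature tensor of $\bar\nabla$ is $\bar W_2(X,Y)Z=\bar R(X,Y)Z+\frac{1}{\dim M-1}\bigl[g(X,Z)\bar QY-g(Y,Z)\bar QX\bigr]$. For real constants $\lambda,\mu$, the data $(g,\xi,\lambda,\mu)$ is an $\eta$-Ricci soliton on $M$ if $\mathcal L_\xi g+2\bar S+2\lambda g+2\mu\,\eta\otimes\eta=0$, where $\mathcal L_\xi g$ is written in terms of $\bar\nabla$, i.e. $2\bar S(X,Y)=-g(\bar\nabla_X\xi,Y)-g(X,\bar\nabla_Y\xi)-2\lambda g(X,Y)-2\mu\eta(X)\eta(Y)$ for all vector fields $X,Y$. If $\mu=0$, $(g,\xi,\lambda)$ is called a Ricci soliton; it is shrinking, steady or expanding according as $\lambda<0$, $\lambda=0$ or $\lambda>0$. *)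

theory Defs
  imports "HOL-Analysis.Analysis"
begin

section \<open>Smooth maps between Euclidean spaces\<close>

text \<open>Meant for open \<open>S\<close>: all iterated directional derivatives up to order \<open>k\<close> exist and
  are continuous.\<close>

primrec Ck_on ::
  "nat \<Rightarrow> ('a::euclidean_space) set \<Rightarrow> ('a \<Rightarrow> 'b::real_normed_vector) \<Rightarrow> bool" where
  "Ck_on 0 S f \<longleftrightarrow> continuous_on S f"
| "Ck_on (Suc k) S f \<longleftrightarrow>
     (\<forall>x\<in>S. f differentiable (at x)) \<and>
     (\<forall>v. Ck_on k S (\<lambda>x. frechet_derivative f (at x) v))"

definition smooth_on ::
  "('a::euclidean_space) set \<Rightarrow> ('a \<Rightarrow> 'b::real_normed_vector) \<Rightarrow> bool" where
  "smooth_on S f \<longleftrightarrow> (\<forall>k. Ck_on k S f)"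


section \<open>Smooth manifolds, functions and vector fields\<close>

text \<open>The manifold is a whole Hausdorff, second countable type \<open>'m\<close>; its dimension is
  \<open>CARD('n)\<close>. A chart \<open>(U, c)\<close> consists of its domain and a map that is only relevant on \<open>U\<close>.
  The atlas need not be maximal: it determines the smooth structure.\<close>

type_synonym ('m, 'n) chart = "'m set \<times> ('m \<Rightarrow> real ^ 'n)"

definition chart_inv :: "('m, 'n::finite) chart \<Rightarrow> real ^ 'n \<Rightarrow> 'm" where
  "chart_inv C = inv_into (fst C) (snd C)"

definition chart_image :: "('m, 'n::finite) chart \<Rightarrow> (real ^ 'n) set" where
  "chart_image C = snd C ` fst C"

definition smooth_atlas ::
  "('m::{t2_space, second_countable_topology}, 'n::finite) chart set \<Rightarrow> bool" where
  "smooth_atlas A \<longleftrightarrow>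
     (\<forall>C\<in>A. open (fst C) \<and> open (chart_image C) \<and>
        homeomorphism (fst C) (chart_image C) (snd C) (chart_inv C)) \<and>
     (\<Union>C\<in>A. fst C) = UNIV \<and>
     (\<forall>C\<in>A. \<forall>D\<in>A. smooth_on (snd C ` (fst C \<inter> fst D)) (snd D \<circ> chart_inv C))"

definition smooth_fun :: "('m, 'n::finite) chart set \<Rightarrow> ('m \<Rightarrow> real) \<Rightarrow> bool" where
  "smooth_fun A f \<longleftrightarrow> (\<forall>C\<in>A. smooth_on (chart_image C) (f \<circ> chart_inv C))"

text \<open>A preferred chart is chosen at every point \<open>p\<close>, and the tangent space at \<open>p\<close> is identified
  with \<open>real ^ 'n\<close> through the coordinate basis of that chart. Since the preferred chart jumps
  from point to point, a vector field is smooth when its components in each fixed chart of the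
  atlas are smooth, not when it is smooth as a map into \<open>real ^ 'n\<close>.\<close>

definition chart_at :: "('m, 'n::finite) chart set \<Rightarrow> 'm \<Rightarrow> ('m, 'n) chart" where
  "chart_at A p = (SOME C. C \<in> A \<and> p \<in> fst C)"

type_synonym ('m, 'n) vfield = "'m \<Rightarrow> real ^ 'n"

definition vf_components ::
  "('m, 'n::finite) chart set \<Rightarrow> ('m, 'n) chart \<Rightarrow> ('m, 'n) vfield \<Rightarrow> real ^ 'n \<Rightarrow> real ^ 'n" where
  "vf_components A C X x =
     (let p = chart_inv C x; D = chart_at A p in
        frechet_derivative (snd C \<circ> chart_inv D) (at (snd D p)) (X p))"

definition vector_field :: "('m, 'n::finite) chart set \<Rightarrow> ('m, 'n) vfield \<Rightarrow> bool" where
  "vector_field A X \<longleftrightarrow> (\<forall>C\<in>A. smooth_on (chart_image C) (vf_components A C X))"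

text \<open>The function \<open>X f\<close>.\<close>

definition vf_apply ::
  "('m, 'n::finite) chart set \<Rightarrow> ('m, 'n) vfield \<Rightarrow> ('m \<Rightarrow> real) \<Rightarrow> 'm \<Rightarrow> real" where
  "vf_apply A X f p =
     (let C = chart_at A p in
        frechet_derivative (f \<circ> chart_inv C) (at (snd C p)) (X p))"

text \<open>In coordinates, the bracket of \<open>X\<close> and \<open>Y\<close> has components
  \<open>X\<^sup>i \<partial>\<^sub>i Y\<^sup>j - Y\<^sup>i \<partial>\<^sub>i X\<^sup>j\<close>.\<close>

definition lie_bracket ::
  "('m, 'n::finite) chart set \<Rightarrow> ('m, 'n) vfield \<Rightarrow> ('m, 'n) vfield \<Rightarrow> ('m, 'n) vfield" where
  "lie_bracket A X Y p =
     (let C = chart_at A p in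
        frechet_derivative (vf_components A C Y) (at (snd C p)) (X p)
      - frechet_derivative (vf_components A C X) (at (snd C p)) (Y p))"


section \<open>Tensor fields and linear connections\<close>

text \<open>Tensor fields are families of (multi)linear maps on the tangent spaces; they are smooth
  when they send smooth vector fields to smooth functions or vector fields.\<close>

type_synonym ('m, 'n) one_form = "'m \<Rightarrow> real ^ 'n \<Rightarrow> real"
type_synonym ('m, 'n) endo_field = "'m \<Rightarrow> real ^ 'n \<Rightarrow> real ^ 'n"
type_synonym ('m, 'n) two_tensor = "'m \<Rightarrow> real ^ 'n \<Rightarrow> real ^ 'n \<Rightarrow> real"

definition smooth_one_form ::
  "('m, 'n::finite) chart set \<Rightarrow> ('m, 'n) one_form \<Rightarrow> bool" where
  "smooth_one_form A eta \<longleftrightarrow>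
     (\<forall>p. linear (eta p)) \<and>
     (\<forall>X. vector_field A X \<longrightarrow> smooth_fun A (\<lambda>p. eta p (X p)))"

definition smooth_endo_field ::
  "('m, 'n::finite) chart set \<Rightarrow> ('m, 'n) endo_field \<Rightarrow> bool" where
  "smooth_endo_field A phi \<longleftrightarrow>
     (\<forall>p. linear (phi p)) \<and>
     (\<forall>X. vector_field A X \<longrightarrow> vector_field A (\<lambda>p. phi p (X p)))"

definition riemannian_metric ::
  "('m, 'n::finite) chart set \<Rightarrow> ('m, 'n) two_tensor \<Rightarrow> bool" where
  "riemannian_metric A g \<longleftrightarrow>
     (\<forall>p. bilinear (g p)) \<and>
     (\<forall>p v w. g p v w = g p w v) \<and>
     (\<forall>p v. v \<noteq> 0 \<longrightarrow> g p v v > 0) \<and>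
     (\<forall>X Y. vector_field A X \<longrightarrow> vector_field A Y \<longrightarrow>
        smooth_fun A (\<lambda>p. g p (X p) (Y p)))"

text \<open>A connection is only constrained on smooth vector fields.\<close>

type_synonym ('m, 'n) conn = "('m, 'n) vfield \<Rightarrow> ('m, 'n) vfield \<Rightarrow> ('m, 'n) vfield"

definition linear_connection ::
  "('m, 'n::finite) chart set \<Rightarrow> ('m, 'n) conn \<Rightarrow> bool" where
  "linear_connection A nabla \<longleftrightarrow>
     (\<forall>X Y. vector_field A X \<longrightarrow> vector_field A Y \<longrightarrow> vector_field A (nabla X Y)) \<and>
     (\<forall>X Y Z. vector_field A X \<longrightarrow> vector_field A Y \<longrightarrow> vector_field A Z \<longrightarrow>
        nabla (\<lambda>p. X p + Y p) Z = (\<lambda>p. nabla X Z p + nabla Y Z p) \<and>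
        nabla X (\<lambda>p. Y p + Z p) = (\<lambda>p. nabla X Y p + nabla X Z p)) \<and>
     (\<forall>f X Y. smooth_fun A f \<longrightarrow> vector_field A X \<longrightarrow> vector_field A Y \<longrightarrow>
        nabla (\<lambda>p. f p *\<^sub>R X p) Y = (\<lambda>p. f p *\<^sub>R nabla X Y p) \<and>
        nabla X (\<lambda>p. f p *\<^sub>R Y p) = (\<lambda>p. vf_apply A X f p *\<^sub>R Y p + f p *\<^sub>R nabla X Y p))"

definition metric_connection ::
  "('m, 'n::finite) chart set \<Rightarrow> ('m, 'n) two_tensor \<Rightarrow> ('m, 'n) conn \<Rightarrow> bool" where
  "metric_connection A g nabla \<longleftrightarrow>
     linear_connection A nabla \<and>
     (\<forall>X Y Z. vector_field A X \<longrightarrow> vector_field A Y \<longrightarrow> vector_field A Z \<longrightarrow>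
        (\<forall>p. vf_apply A X (\<lambda>q. g q (Y q) (Z q)) p =
             g p (nabla X Y p) (Z p) + g p (Y p) (nabla X Z p)))"

definition torsion ::
  "('m, 'n::finite) chart set \<Rightarrow> ('m, 'n) conn \<Rightarrow>
     ('m, 'n) vfield \<Rightarrow> ('m, 'n) vfield \<Rightarrow> ('m, 'n) vfield" where
  "torsion A nabla X Y p = nabla X Y p - nabla Y X p - lie_bracket A X Y p"

definition levi_civita ::
  "('m, 'n::finite) chart set \<Rightarrow> ('m, 'n) two_tensor \<Rightarrow> ('m, 'n) conn \<Rightarrow> bool" where
  "levi_civita A g nabla \<longleftrightarrow>
     metric_connection A g nabla \<and>
     (\<forall>X Y. vector_field A X \<longrightarrow> vector_field A Y \<longrightarrow> (\<forall>p. torsion A nabla X Y p = 0))"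


section \<open>Curvature\<close>

definition curvature ::
  "('m, 'n::finite) chart set \<Rightarrow> ('m, 'n) conn \<Rightarrow>
     ('m, 'n) vfield \<Rightarrow> ('m, 'n) vfield \<Rightarrow> ('m, 'n) vfield \<Rightarrow> ('m, 'n) vfield" where
  "curvature A nabla X Y Z p =
     nabla X (nabla Y Z) p - nabla Y (nabla X Z) p - nabla (lie_bracket A X Y) Z p"

text \<open>The value at \<open>p\<close> of a tensorial operator \<open>F\<close> on vector fields, as an endomorphism of the
  tangent space at \<open>p\<close>: \<open>F X p\<close> depends only on \<open>X p\<close>, and every tangent vector at \<open>p\<close> is the value
  of some smooth vector field.\<close>

definition endo_at ::
  "('m, 'n::finite) chart set \<Rightarrow> (('m, 'n) vfield \<Rightarrow> ('m, 'n) vfield) \<Rightarrow> ('m, 'n) endo_field" where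
  "endo_at A F p v = (THE w. \<forall>X. vector_field A X \<and> X p = v \<longrightarrow> F X p = w)"

definition ricci ::
  "('m, 'n::finite) chart set \<Rightarrow> ('m, 'n) conn \<Rightarrow>
     ('m, 'n) vfield \<Rightarrow> ('m, 'n) vfield \<Rightarrow> 'm \<Rightarrow> real" where
  "ricci A nabla Y Z p = trace (matrix (endo_at A (\<lambda>X. curvature A nabla X Y Z) p))"

definition ricci_operator ::
  "('m, 'n::finite) chart set \<Rightarrow> ('m, 'n) two_tensor \<Rightarrow> ('m, 'n) conn \<Rightarrow>
     ('m, 'n) vfield \<Rightarrow> ('m, 'n) vfield" where
  "ricci_operator A g nabla X =
     (THE V. vector_field A V \<and>
        (\<forall>Y. vector_field A Y \<longrightarrow> (\<forall>p. g p (V p) (Y p) = ricci A nabla X Y p)))"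

definition W2_curvature ::
  "('m, 'n::finite) chart set \<Rightarrow> ('m, 'n) two_tensor \<Rightarrow> ('m, 'n) conn \<Rightarrow>
     ('m, 'n) vfield \<Rightarrow> ('m, 'n) vfield \<Rightarrow> ('m, 'n) vfield \<Rightarrow> ('m, 'n) vfield" where
  "W2_curvature A g nabla X Y Z p =
     curvature A nabla X Y Z p
     + (1 / (real CARD('n) - 1)) *\<^sub>R
         (g p (X p) (Z p) *\<^sub>R ricci_operator A g nabla Y p
          - g p (Y p) (Z p) *\<^sub>R ricci_operator A g nabla X p)"


section \<open>Kenmotsu manifolds and generalized symmetric metric connections\<close>

definition almost_contact_metric ::
  "('m::{t2_space, second_countable_topology}, 'n::finite) chart set \<Rightarrow> ('m, 'n) endo_field \<Rightarrow>
     ('m, 'n) vfield \<Rightarrow> ('m, 'n) one_form \<Rightarrow> ('m, 'n) two_tensor \<Rightarrow> bool" where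
  "almost_contact_metric A phi xi eta g \<longleftrightarrow>
     smooth_atlas A \<and> odd CARD('n) \<and>
     smooth_endo_field A phi \<and> vector_field A xi \<and> smooth_one_form A eta \<and>
     riemannian_metric A g \<and>
     (\<forall>p. phi p (xi p) = 0 \<and> eta p (xi p) = 1) \<and>
     (\<forall>p v. eta p (phi p v) = 0 \<and>
            phi p (phi p v) = - v + eta p v *\<^sub>R xi p \<and>
            g p v (xi p) = eta p v) \<and>
     (\<forall>p v w. g p (phi p v) (phi p w) = g p v w - eta p v * eta p w)"

text \<open>The Levi-Civita connection exists and is unique on smooth vector fields, so quantifying it
  existentially says that it satisfies the two identities. In the first one the left-hand
  side is the covariant derivative of \<open>phi\<close> along \<open>X\<close>, applied to \<open>Y\<close>.\<close>

definition kenmotsu ::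
  "('m::{t2_space, second_countable_topology}, 'n::finite) chart set \<Rightarrow> ('m, 'n) endo_field \<Rightarrow>
     ('m, 'n) vfield \<Rightarrow> ('m, 'n) one_form \<Rightarrow> ('m, 'n) two_tensor \<Rightarrow> bool" where
  "kenmotsu A phi xi eta g \<longleftrightarrow>
     almost_contact_metric A phi xi eta g \<and>
     (\<exists>nabla. levi_civita A g nabla \<and>
        (\<forall>X Y. vector_field A X \<longrightarrow> vector_field A Y \<longrightarrow>
           (\<forall>p. nabla X (\<lambda>q. phi q (Y q)) p - phi p (nabla X Y p) =
                g p (phi p (X p)) (Y p) *\<^sub>R xi p - eta p (Y p) *\<^sub>R phi p (X p))) \<and>
        (\<forall>X. vector_field A X \<longrightarrow>
           (\<forall>p. nabla X xi p = X p - eta p (X p) *\<^sub>R xi p)))"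

definition generalized_symmetric_metric_connection ::
  "('m, 'n::finite) chart set \<Rightarrow> ('m, 'n) endo_field \<Rightarrow> ('m, 'n) one_form \<Rightarrow>
     ('m, 'n) two_tensor \<Rightarrow> ('m \<Rightarrow> real) \<Rightarrow> ('m \<Rightarrow> real) \<Rightarrow> ('m, 'n) conn \<Rightarrow> bool" where
  "generalized_symmetric_metric_connection A phi eta g alpha beta nabla \<longleftrightarrow>
     smooth_fun A alpha \<and> smooth_fun A beta \<and>
     metric_connection A g nabla \<and>
     (\<forall>X Y. vector_field A X \<longrightarrow> vector_field A Y \<longrightarrow>
        (\<forall>p. torsion A nabla X Y p =
             alpha p *\<^sub>R (eta p (Y p) *\<^sub>R X p - eta p (X p) *\<^sub>R Y p)
             + beta p *\<^sub>R (eta p (Y p) *\<^sub>R phi p (X p) - eta p (X p) *\<^sub>R phi p (Y p))))"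


section \<open>Ricci solitons\<close>

text \<open>The Lie derivative of \<open>g\<close> along \<open>xi\<close>, written in terms of the given connection (which may
  have torsion, so this is a convention rather than the usual Lie derivative).\<close>

definition lie_metric ::
  "('m, 'n::finite) two_tensor \<Rightarrow> ('m, 'n) conn \<Rightarrow> ('m, 'n) vfield \<Rightarrow>
     ('m, 'n) vfield \<Rightarrow> ('m, 'n) vfield \<Rightarrow> 'm \<Rightarrow> real" where
  "lie_metric g nabla xi X Y p = g p (nabla X xi p) (Y p) + g p (X p) (nabla Y xi p)"

definition eta_ricci_soliton ::
  "('m, 'n::finite) chart set \<Rightarrow> ('m, 'n) two_tensor \<Rightarrow> ('m, 'n) conn \<Rightarrow> ('m, 'n) vfield \<Rightarrow>
     ('m, 'n) one_form \<Rightarrow> real \<Rightarrow> real \<Rightarrow> bool" where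
  "eta_ricci_soliton A g nabla xi eta lam mu \<longleftrightarrow>
     (\<forall>X Y. vector_field A X \<longrightarrow> vector_field A Y \<longrightarrow>
        (\<forall>p. lie_metric g nabla xi X Y p + 2 * ricci A nabla X Y p
             + 2 * lam * g p (X p) (Y p) + 2 * mu * (eta p (X p) * eta p (Y p)) = 0))"

definition ricci_soliton ::
  "('m, 'n::finite) chart set \<Rightarrow> ('m, 'n) two_tensor \<Rightarrow> ('m, 'n) conn \<Rightarrow> ('m, 'n) vfield \<Rightarrow>
     ('m, 'n) one_form \<Rightarrow> real \<Rightarrow> bool" where
  "ricci_soliton A g nabla xi eta lam \<longleftrightarrow> eta_ricci_soliton A g nabla xi eta lam 0"

definition shrinking :: "real \<Rightarrow> bool" where "shrinking lam \<longleftrightarrow> lam < 0"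
definition steady :: "real \<Rightarrow> bool" where "steady lam \<longleftrightarrow> lam = 0"
definition expanding :: "real \<Rightarrow> bool" where "expanding lam \<longleftrightarrow> lam > 0"

end

theory Submission
  imports Defs
begin

text \<open>Write \<open>h X = X - \<eta>(X) \<xi>\<close> and \<open>n = dim M\<close>. Comparing the metric connection with the Levi-Civita
  connection gives \<open>\<nabla>_X \<xi> = (1 + \<alpha>) h X\<close>, so that
  \<open>R(X,\<xi>)\<xi> = - (\<xi>(\<alpha>) + 1 + \<alpha>) h X + (1 + \<alpha>) \<beta> \<phi> X\<close> and, as \<open>\<phi>\<close> has trace zero,
  \<open>S(\<xi>,\<xi>) = - (n - 1) (\<xi>(\<alpha>) + 1 + \<alpha>)\<close>. For a steady soliton \<open>S(X,Y) = - (1 + \<alpha>) g(h X, Y)\<close>;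
  hence \<open>S(\<xi>,\<xi>) = 0\<close>, which kills the first term of \<open>R(X,\<xi>)\<xi>\<close>. Since \<open>S(\<sqdot>,\<xi>) = 0\<close>, the
  hypothesis for \<open>Y = X\<close>, \<open>Z = \<xi>\<close> becomes \<open>S(X, W_2(\<xi>,X)\<xi>) = 0\<close>, and as \<open>g(h X, \<phi> X) = 0\<close> this says
  \<open>(1 + \<alpha>)^2 g(h X, h X) / (n - 1) = 0\<close> for every \<open>X\<close>: a contradiction where \<open>\<alpha> \<noteq> -1\<close>.
  Bump functions are needed to extend tangent vectors to global vector fields.\<close>

section \<open>Calculus of smooth maps\<close>

text \<open>On an open set a derivative only sees nearby values, so agreement passes to all
  derivatives. Components of fields have closed formulas only on parts of chart images; smoothness
  is transferred to them this way.\<close>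

lemma Ck_on_cong:
  assumes "open S" "\<And>x. x \<in> S \<Longrightarrow> f x = g x" "Ck_on k S f"
  shows "Ck_on k S g"
  using assms(2,3)
proof (induction k arbitrary: f g)
  case 0
  then show ?case using continuous_on_cong[of S S f g] by simp
next
  case (Suc k)
  have "(g has_derivative frechet_derivative f (at x)) (at x)" if "x \<in> S" for x
    using Suc.prems that assms(1)
    by (intro has_derivative_transform_within_open[of f _ x UNIV S g])
       (auto simp: frechet_derivative_works)
  then have g: "g differentiable (at x) \<and> frechet_derivative g (at x) = frechet_derivative f (at x)"
    if "x \<in> S" for x
    using that by (metis differentiable_def frechet_derivative_at)
  show ?case
    using g Suc.IH[of "\<lambda>x. frechet_derivative f (at x) v" "\<lambda>x. frechet_derivative g (at x) v" for v]
      Suc.prems by auto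
qed

lemma Ck_on_SucI:
  assumes "open S" "\<And>x. x \<in> S \<Longrightarrow> (f has_derivative f' x) (at x)"
    "\<And>v. Ck_on k S (\<lambda>x. f' x v)"
  shows "Ck_on (Suc k) S f"
proof -
  have "frechet_derivative f (at x) = f' x" if "x \<in> S" for x
    using assms(2)[OF that] by (metis frechet_derivative_at)
  then have "Ck_on k S (\<lambda>x. frechet_derivative f (at x) v)" for v
    using Ck_on_cong[OF assms(1) _ assms(3)] by simp
  then show ?thesis
    using assms(2) by (auto simp: differentiable_def)
qed

lemma Ck_on_Suc_has_derivative:
  "Ck_on (Suc k) S f \<Longrightarrow> x \<in> S \<Longrightarrow> (f has_derivative frechet_derivative f (at x)) (at x)"
  by (simp add: frechet_derivative_works)

lemma Ck_on_SucD: "Ck_on (Suc k) S f \<Longrightarrow> Ck_on k S f"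
proof (induction k arbitrary: f)
  case 0
  then show ?case
    by (auto intro!: continuous_at_imp_continuous_on differentiable_imp_continuous_within)
qed simp

lemma Ck_on_Un:
  "open S \<Longrightarrow> open T \<Longrightarrow> Ck_on k S f \<Longrightarrow> Ck_on k T f \<Longrightarrow> Ck_on k (S \<union> T) f"
  by (induction k arbitrary: f) (auto intro: continuous_on_open_Un)

lemma Ck_on_const: "Ck_on k S (\<lambda>x. c)"
  by (induction k arbitrary: c) (auto simp: frechet_derivative_const)

lemma Ck_on_linear:
  assumes "open S" "bounded_linear f" shows "Ck_on k S f"
proof (cases k)
  case 0
  then show ?thesis using assms(2) by (simp add: linear_continuous_on)
next
  case (Suc j)
  then show ?thesis
    using Ck_on_SucI[OF assms(1), of f "\<lambda>_. f"] bounded_linear_imp_has_derivative[OF assms(2)]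
      Ck_on_const by blast
qed

lemma Ck_on_add:
  assumes "open S" "Ck_on k S f" "Ck_on k S g" shows "Ck_on k S (\<lambda>x. f x + g x)"
  using assms(2,3)
proof (induction k arbitrary: f g)
  case (Suc k)
  then show ?case
    by (intro Ck_on_SucI[where f'="\<lambda>x v. frechet_derivative f (at x) v + frechet_derivative g (at x) v"]
        assms(1) has_derivative_add) (auto intro: Ck_on_Suc_has_derivative)
qed (auto intro: continuous_on_add)

lemma Ck_on_sum:
  assumes "open S" "\<And>i. i \<in> I \<Longrightarrow> Ck_on k S (f i)" shows "Ck_on k S (\<lambda>x. \<Sum>i\<in>I. f i x)"
  using assms(2)
  by (induction I rule: infinite_finite_induct) (auto intro: Ck_on_const Ck_on_add assms(1))

text \<open>By the Leibniz rule the derivative is again a sum of products under \<open>h\<close>, so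
  the induction closes. The instances are multiplication, scaling and the inner product.\<close>

lemma Ck_on_bilinear:
  assumes "bounded_bilinear h" "open S" "Ck_on k S f" "Ck_on k S g"
  shows "Ck_on k S (\<lambda>x. h (f x) (g x))"
  using assms(3,4)
proof (induction k arbitrary: f g)
  case 0
  then show ?case using bounded_bilinear.continuous_on[OF assms(1)] by auto
next
  case (Suc k)
  let ?D = "\<lambda>x v. h (f x) (frechet_derivative g (at x) v) + h (frechet_derivative f (at x) v) (g x)"
  show ?case
  proof (rule Ck_on_SucI[where f'="?D"])
    show "((\<lambda>x. h (f x) (g x)) has_derivative ?D x) (at x)" if "x \<in> S" for x
      using bounded_bilinear.FDERIV[OF assms(1)] Suc.prems that
      by (blast intro: Ck_on_Suc_has_derivative)
    show "Ck_on k S (\<lambda>x. ?D x v)" for v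
      using Suc.prems Ck_on_SucD[OF Suc.prems(1)] Ck_on_SucD[OF Suc.prems(2)]
      by (auto intro!: Ck_on_add Suc.IH assms(2))
  qed (rule assms(2))
qed

lemma Ck_on_compose:
  fixes f :: "'a::euclidean_space \<Rightarrow> 'b::euclidean_space" and g :: "'b \<Rightarrow> 'c::real_normed_vector"
  assumes "open S" "open T" "f ` S \<subseteq> T" "Ck_on k S f" "Ck_on k T g"
  shows "Ck_on k S (\<lambda>x. g (f x))"
  using assms(4,5)
proof (induction k arbitrary: g)
  case 0
  then show ?case using assms(3) by (auto intro: continuous_on_compose2)
next
  case (Suc k)
  \<comment> \<open>\<open>Ck_on\<close> controls derivatives in fixed directions only. Expanding
    the chain rule over the basis turns the moving direction into scalar coefficients and
    differentiates \<open>g\<close> along fixed \<open>b\<close>.\<close>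
  let ?D = "\<lambda>x v. \<Sum>b\<in>Basis. (frechet_derivative f (at x) v \<bullet> b) *\<^sub>R frechet_derivative g (at (f x)) b"
  show ?case
  proof (rule Ck_on_SucI[where f'="?D"])
    fix x assume x: "x \<in> S"
    have g: "(g has_derivative frechet_derivative g (at (f x))) (at (f x))"
      using Suc.prems(2) assms(3) x by (intro Ck_on_Suc_has_derivative) auto
    then have "linear (frechet_derivative g (at (f x)))"
      by (rule has_derivative_linear)
    then have "frechet_derivative g (at (f x)) w
        = (\<Sum>b\<in>Basis. (w \<bullet> b) *\<^sub>R frechet_derivative g (at (f x)) b)" for w
      using linear_sum[of "frechet_derivative g (at (f x))" "\<lambda>b. (w \<bullet> b) *\<^sub>R b" Basis]
      by (simp add: euclidean_representation linear_cmul)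
    then have "(\<lambda>v. frechet_derivative g (at (f x)) (frechet_derivative f (at x) v)) = ?D x"
      by blast
    then show "((\<lambda>x. g (f x)) has_derivative ?D x) (at x)"
      using has_derivative_compose[OF Ck_on_Suc_has_derivative[OF Suc.prems(1) x] g] by (simp only:)
  next
    show "Ck_on k S (\<lambda>x. ?D x v)" for v
    proof (intro Ck_on_sum assms(1) Ck_on_bilinear[OF bounded_bilinear_scaleR]
        Ck_on_bilinear[OF bounded_bilinear_inner] Ck_on_const)
      show "Ck_on k S (\<lambda>x. frechet_derivative f (at x) v)"
        using Suc.prems(1) by simp
      show "Ck_on k S (\<lambda>x. frechet_derivative g (at (f x)) b)" for b
        using Suc.IH[of "\<lambda>y. frechet_derivative g (at y) b"] Ck_on_SucD[OF Suc.prems(1)] Suc.prems(2)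
        by simp
    qed
  qed (rule assms(1))
qed

section \<open>Bump functions\<close>

text \<open>This family of functions is closed under differentiation up to linear combinations, which
  makes smoothness a plain induction.\<close>

definition flat_exp :: "nat \<Rightarrow> real \<Rightarrow> real" where
  "flat_exp n t = (if t > 0 then exp (- inverse t) * inverse t ^ n else 0)"

text \<open>On the right, substitute s = 1/t: the quotient \<open>s ^ n / exp s\<close> tends to 0
  at infinity.\<close>

lemma flat_exp_tendsto_0: "(flat_exp n \<longlongrightarrow> 0) (at 0)"
proof -
  have "((\<lambda>t::real. inverse t ^ n / exp (inverse t)) \<longlongrightarrow> 0) (at_right 0)"
    by (rule filterlim_compose[OF tendsto_power_div_exp_0 filterlim_inverse_at_top_right])
  then have "(flat_exp n \<longlongrightarrow> 0) (at_right 0)"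
    by (rule Lim_transform_eventually)
      (auto simp: eventually_at_filter flat_exp_def exp_minus field_simps)
  moreover have "(flat_exp n \<longlongrightarrow> 0) (at_left 0)"
    by (rule Lim_transform_eventually[of "\<lambda>_. 0"]) (auto simp: eventually_at_filter flat_exp_def)
  ultimately show ?thesis by (simp add: filterlim_split_at)
qed

lemma flat_exp_has_real_derivative:
  "(flat_exp n has_real_derivative flat_exp (n + 2) t - real n * flat_exp (n + 1) t) (at t)"
proof (cases t "0::real" rule: linorder_cases)
  case less
  show ?thesis
    by (rule DERIV_cong[OF has_field_derivative_transform_within_open[of "\<lambda>_. 0" 0 t "{..<0}"]])
      (use less in \<open>auto simp: flat_exp_def\<close>)
next
  case equal
  \<comment> \<open>For nonzero \<open>h\<close> the difference quotient at 0 is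
    \<open>flat_exp (Suc n) h\<close>, which tends to 0.\<close>
  have "((\<lambda>h. (flat_exp n (0 + h) - flat_exp n 0) / h) \<longlongrightarrow> 0) (at 0)"
    by (rule Lim_transform_eventually[OF flat_exp_tendsto_0[of "Suc n"]])
      (auto simp: eventually_at_filter flat_exp_def field_simps)
  then show ?thesis by (simp add: equal DERIV_def flat_exp_def)
next
  case greater
  have i: "((\<lambda>t. inverse t) has_real_derivative - (inverse t)\<^sup>2) (at t)"
    using DERIV_inverse[of t UNIV] greater by (simp add: power2_eq_square)
  have d: "((\<lambda>t. exp (- inverse t) * inverse t ^ n) has_real_derivative
        exp (- inverse t) * inverse t ^ (n + 2) - real n * (exp (- inverse t) * inverse t ^ (n + 1))) (at t)"
    by (rule DERIV_cong[OF DERIV_mult[OF DERIV_chain2[OF DERIV_exp DERIV_minus[OF i]] DERIV_power[OF i]]])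
      (cases n; simp add: algebra_simps power2_eq_square)
  show ?thesis
    by (rule DERIV_cong[OF has_field_derivative_transform_within_open[OF d, of "{0<..}"]])
      (use greater in \<open>auto simp: flat_exp_def\<close>)
qed

lemma Ck_on_flat_exp: "Ck_on k UNIV (flat_exp n)"
proof (induction k arbitrary: n)
  case 0
  then show ?case
    using DERIV_isCont[OF flat_exp_has_real_derivative] by (simp add: continuous_at_imp_continuous_on)
next
  case (Suc k)
  show ?case
  proof (rule Ck_on_SucI[OF open_UNIV])
    show "(flat_exp n has_derivative
        (\<lambda>v. (flat_exp (n + 2) t + (- real n) * flat_exp (n + 1) t) * v)) (at t)" for t
      using flat_exp_has_real_derivative[of n t] by (simp add: has_field_derivative_def)
    show "Ck_on k UNIV (\<lambda>t. (flat_exp (n + 2) t + (- real n) * flat_exp (n + 1) t) * v)" for v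
      by (intro Ck_on_bilinear[OF bounded_bilinear_mult] Ck_on_add Ck_on_const Suc open_UNIV)
  qed
qed

lemma smooth_bump_exists:
  fixes a :: "'a::euclidean_space"
  assumes "r > 0"
  obtains f :: "'a \<Rightarrow> real" where "\<And>k. Ck_on k UNIV f" "f a = 1" "\<And>x. x \<notin> cball a r \<Longrightarrow> f x = 0"
proof
  \<comment> \<open>This is r^2 - |x - a|^2, written with an inner product so that bilinearity gives
    smoothness. It is positive exactly inside the open ball; \<open>?f\<close> normalises by the
    value at the centre.\<close>
  let ?q = "\<lambda>x. r\<^sup>2 + (x - a) \<bullet> (a - x)"
  let ?f = "\<lambda>x. flat_exp 0 (?q x) * inverse (flat_exp 0 (r\<^sup>2))"
  have l: "Ck_on k UNIV (\<lambda>x. x - a)" "Ck_on k UNIV (\<lambda>x. a - x)" for k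
    using Ck_on_add[OF open_UNIV Ck_on_linear[OF open_UNIV bounded_linear_ident] Ck_on_const[of _ _ "-a"]]
      Ck_on_add[OF open_UNIV Ck_on_const[of _ _ a]
        Ck_on_linear[OF open_UNIV bounded_linear_minus[OF bounded_linear_ident]]]
    by simp_all
  have "Ck_on k UNIV ?q" for k
    by (intro Ck_on_add Ck_on_const Ck_on_bilinear[OF bounded_bilinear_inner] l open_UNIV)
  then show "Ck_on k UNIV ?f" for k
    by (intro Ck_on_bilinear[OF bounded_bilinear_mult] Ck_on_const
        Ck_on_compose[OF _ _ _ _ Ck_on_flat_exp]) auto
  show "?f a = 1" using assms by (simp add: flat_exp_def)
  show "?f x = 0" if "x \<notin> cball a r" for x
  proof -
    have "r\<^sup>2 \<le> (dist a x)\<^sup>2" using that assms by (intro power_mono) auto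
    also have "(dist a x)\<^sup>2 = - ((x - a) \<bullet> (a - x))"
      by (simp add: dist_norm power2_norm_eq_inner inner_diff inner_commute)
    finally show ?thesis by (simp add: flat_exp_def)
  qed
qed

section \<open>Vector fields on manifolds\<close>

locale smooth_manifold =
  fixes A :: "('m::{t2_space, second_countable_topology}, 'n::finite) chart set"
  assumes atlas: "smooth_atlas A"
begin

section \<open>Charts and transition maps\<close>

lemma chart_at: "chart_at A p \<in> A" "p \<in> fst (chart_at A p)"
proof -
  have "\<exists>C. C \<in> A \<and> p \<in> fst C"
    using atlas unfolding smooth_atlas_def by blast
  then show "chart_at A p \<in> A" "p \<in> fst (chart_at A p)"
    unfolding chart_at_def by (metis (mono_tags, lifting) someI_ex)+
qed

lemma chart_homeomorphism:
  assumes "C \<in> A"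
  shows "open (fst C)" "open (chart_image C)"
    "homeomorphism (fst C) (chart_image C) (snd C) (chart_inv C)"
  using atlas assms unfolding smooth_atlas_def by blast+

lemma chart_inv_snd: "C \<in> A \<Longrightarrow> q \<in> fst C \<Longrightarrow> chart_inv C (snd C q) = q"
  using chart_homeomorphism(3) by (auto simp: homeomorphism_def)

lemma snd_chart_inv:
  assumes "C \<in> A" "y \<in> chart_image C"
  shows "snd C (chart_inv C y) = y" "chart_inv C y \<in> fst C"
  using chart_homeomorphism(3)[OF assms(1)] assms(2) by (auto simp: homeomorphism_def)

lemma open_chart_open:
  assumes "C \<in> A" "open W"
  shows "open (snd C ` (fst C \<inter> W))"
proof -
  have "openin (top_of_set (chart_image C)) (snd C ` (fst C \<inter> W))"
    using homeomorphism_imp_open_map[OF chart_homeomorphism(3)[OF assms(1)]] assms(2)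
    by (metis Int_commute openin_open_Int)
  then show ?thesis
    using chart_homeomorphism(2)[OF assms(1)] openin_open_trans by blast
qed

abbreviation transition ::
    "('m, 'n) chart \<Rightarrow> ('m, 'n) chart \<Rightarrow> real ^ 'n \<Rightarrow> real ^ 'n \<Rightarrow> real ^ 'n" where
  "transition C D y \<equiv> frechet_derivative (snd D \<circ> chart_inv C) (at y)"

lemma smooth_transition:
  assumes "C \<in> A" "D \<in> A"
  shows "Ck_on k (snd C ` (fst C \<inter> fst D)) (snd D \<circ> chart_inv C)"
  using atlas assms unfolding smooth_atlas_def smooth_on_def by blast

lemma transition_has_derivative:
  assumes "C \<in> A" "D \<in> A" "q \<in> fst C" "q \<in> fst D"
  shows "((snd D \<circ> chart_inv C) has_derivative transition C D (snd C q)) (at (snd C q))"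
  using Ck_on_Suc_has_derivative[OF smooth_transition[OF assms(1,2), of "Suc 0"]] assms by blast

lemma linear_transition:
  assumes "C \<in> A" "D \<in> A" "q \<in> fst C" "q \<in> fst D"
  shows "linear (transition C D (snd C q))"
  using has_derivative_linear[OF transition_has_derivative[OF assms]] .

text \<open>The chain rule for a composite that equals the direct change of coordinates near
  \<open>snd C q\<close>. It makes the arbitrary preferred charts cancel in components of
  fields.\<close>

lemma transition_cocycle:
  assumes "C \<in> A" "D \<in> A" "E \<in> A" "q \<in> fst C" "q \<in> fst D" "q \<in> fst E"
  shows "transition D E (snd D q) (transition C D (snd C q) v) = transition C E (snd C q) v"
proof -
  have e: "(snd D \<circ> chart_inv C) (snd C q) = snd D q"
    using assms by (simp add: chart_inv_snd)
  have "((\<lambda>y. (snd E \<circ> chart_inv D) ((snd D \<circ> chart_inv C) y)) has_derivative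
      (\<lambda>v. transition D E (snd D q) (transition C D (snd C q) v))) (at (snd C q))"
    using has_derivative_compose[OF transition_has_derivative[OF assms(1,2,4,5)],
        of "snd E \<circ> chart_inv D"] transition_has_derivative[OF assms(2,3,5,6)]
    by (simp only: e)
  then have "((snd E \<circ> chart_inv C) has_derivative
      (\<lambda>v. transition D E (snd D q) (transition C D (snd C q) v))) (at (snd C q))"
    by (rule has_derivative_transform_within_open[OF _ open_chart_open[OF assms(1)
            chart_homeomorphism(1)[OF assms(2)]]])
      (use assms in \<open>auto simp: chart_inv_snd\<close>)
  from has_derivative_unique[OF this transition_has_derivative[OF assms(1,3,4,6)]]
  show ?thesis by metis
qed

lemma transition_self:
  assumes "C \<in> A" "q \<in> fst C"
  shows "transition C C (snd C q) v = v"
proof -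
  have "((snd C \<circ> chart_inv C) has_derivative (\<lambda>v. v)) (at (snd C q))"
    by (rule has_derivative_transform_within_open[OF has_derivative_ident
          chart_homeomorphism(2)[OF assms(1)]])
      (use assms snd_chart_inv(1) in \<open>auto simp: chart_image_def\<close>)
  from has_derivative_unique[OF this transition_has_derivative[OF assms(1,1,2,2)]]
  show ?thesis by metis
qed

section \<open>Smooth functions and smooth vector fields\<close>

lemma vf_components_eq:
  assumes "C \<in> A" "y \<in> chart_image C"
  shows "vf_components A C X y =
    transition (chart_at A (chart_inv C y)) C (snd (chart_at A (chart_inv C y)) (chart_inv C y))
      (X (chart_inv C y))"
  by (simp add: vf_components_def Let_def)

lemma vf_components_linear:
  assumes "C \<in> A" "y \<in> chart_image C"
  shows "vf_components A C (\<lambda>p. X p + Y p) y = vf_components A C X y + vf_components A C Y y"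
    and "vf_components A C (\<lambda>p. f p *\<^sub>R X p) y = f (chart_inv C y) *\<^sub>R vf_components A C X y"
  using linear_transition[OF chart_at(1) assms(1) chart_at(2) snd_chart_inv(2)[OF assms]]
  by (simp_all add: vf_components_eq assms linear_add linear_cmul)

lemma smooth_fun_const: "smooth_fun A (\<lambda>p. c)"
  by (simp add: smooth_fun_def smooth_on_def o_def Ck_on_const)

lemma smooth_fun_add:
  "smooth_fun A f \<Longrightarrow> smooth_fun A h \<Longrightarrow> smooth_fun A (\<lambda>p. f p + h p)"
  using chart_homeomorphism(2) by (auto simp: smooth_fun_def smooth_on_def o_def intro: Ck_on_add)

lemma smooth_fun_mult:
  "smooth_fun A f \<Longrightarrow> smooth_fun A h \<Longrightarrow> smooth_fun A (\<lambda>p. f p * h p)"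
  using chart_homeomorphism(2)
  by (auto simp: smooth_fun_def smooth_on_def o_def intro!: Ck_on_bilinear[OF bounded_bilinear_mult])

lemma smooth_fun_minus: "smooth_fun A f \<Longrightarrow> smooth_fun A (\<lambda>p. - f p)"
  using smooth_fun_mult[OF smooth_fun_const[of "-1"]] by simp

lemma vector_field_add:
  assumes "vector_field A X" "vector_field A Y"
  shows "vector_field A (\<lambda>p. X p + Y p)"
  unfolding vector_field_def smooth_on_def
proof (intro ballI allI)
  fix C k assume C: "C \<in> A"
  show "Ck_on k (chart_image C) (vf_components A C (\<lambda>p. X p + Y p))"
    by (rule Ck_on_cong[OF _ vf_components_linear(1)[OF C, symmetric] Ck_on_add])
      (use C assms chart_homeomorphism(2) in \<open>auto simp: vector_field_def smooth_on_def\<close>)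
qed

lemma vector_field_scale:
  assumes "smooth_fun A f" "vector_field A X"
  shows "vector_field A (\<lambda>p. f p *\<^sub>R X p)"
  unfolding vector_field_def smooth_on_def
proof (intro ballI allI)
  fix C k assume C: "C \<in> A"
  show "Ck_on k (chart_image C) (vf_components A C (\<lambda>p. f p *\<^sub>R X p))"
    by (rule Ck_on_cong[OF _ vf_components_linear(2)[OF C, symmetric]
          Ck_on_bilinear[OF bounded_bilinear_scaleR]])
      (use C assms chart_homeomorphism(2) in
        \<open>auto simp: vector_field_def smooth_fun_def smooth_on_def o_def\<close>)
qed

lemma vector_field_diff:
  assumes "vector_field A X" "vector_field A Y"
  shows "vector_field A (\<lambda>p. X p - Y p)"
  using vector_field_add[OF assms(1) vector_field_scale[OF smooth_fun_const[of "-1"] assms(2)]]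
  by simp

text \<open>The extension is the coordinate-constant field of a chart around \<open>p\<close>, cut off by a bump.\<close>

lemma vector_field_extension:
  obtains X where "vector_field A X" "X p = v"
proof -
  define C where "C = chart_at A p"
  have C: "C \<in> A" "p \<in> fst C" using chart_at by (auto simp: C_def)
  have oC: "open (fst C)" "open (chart_image C)" using chart_homeomorphism C by auto
  have "snd C p \<in> chart_image C" using C by (auto simp: chart_image_def)
  then obtain r where r: "r > 0" "cball (snd C p) r \<subseteq> chart_image C"
    using oC(2) open_contains_cball by blast
  obtain f :: "real ^ 'n \<Rightarrow> real" where f: "\<And>k. Ck_on k UNIV f" "f (snd C p) = 1"
      "\<And>x. x \<notin> cball (snd C p) r \<Longrightarrow> f x = 0"
    using smooth_bump_exists[OF r(1)] by blast
  define K where "K = chart_inv C ` cball (snd C p) r"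
  have "continuous_on (cball (snd C p) r) (chart_inv C)"
    using chart_homeomorphism(3)[OF C(1)] r(2) by (metis homeomorphism_def continuous_on_subset)
  then have "compact K" unfolding K_def by (intro compact_continuous_image compact_cball)
  \<comment> \<open>Compact sets are closed because the manifold is Hausdorff. So \<open>X\<close>
    will vanish on an open set that covers the manifold together with the domain of
    \<open>C\<close>.\<close>
  then have oK: "open (- K)" by (simp add: compact_imp_closed open_Compl)
  \<comment> \<open>Tangent vectors at \<open>q\<close> are written in the basis of
    \<open>chart_at A q\<close>, so the vector with constant components \<open>v\<close> in
    \<open>C\<close> has to be carried over to that chart.\<close>
  define X where "X = (\<lambda>q. if q \<in> fst C
      then f (snd C q) *\<^sub>R transition C (chart_at A q) (snd C q) v else 0)"
  have X0: "X q = 0" if "q \<notin> K" for q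
  proof (cases "q \<in> fst C")
    case True
    then have "snd C q \<notin> cball (snd C p) r"
      using that chart_inv_snd[OF C(1)] unfolding K_def by (metis image_eqI)
    then show ?thesis by (simp add: X_def f(3))
  qed (simp add: X_def)
  have "vector_field A X"
    unfolding vector_field_def smooth_on_def
  proof (intro ballI allI)
    fix E k assume E: "E \<in> A"
    let ?S = "snd E ` (fst E \<inter> fst C)" and ?T = "snd E ` (fst E \<inter> - K)"
    have o: "open ?S" "open ?T" using open_chart_open E oC(1) oK by auto
    have "K \<subseteq> fst C" using r(2) snd_chart_inv(2)[OF C(1)] by (auto simp: K_def)
    then have un: "chart_image E = ?S \<union> ?T" by (auto simp: chart_image_def)
    let ?t = "snd C \<circ> chart_inv E"
    have t: "?t ` ?S \<subseteq> snd C ` (fst C \<inter> fst E)"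
      using chart_inv_snd[OF E] by auto
    have d: "Ck_on k (snd C ` (fst C \<inter> fst E)) (\<lambda>y. transition C E y v)"
      using smooth_transition[OF C(1) E, of "Suc k"] by simp
    have S1: "Ck_on k ?S (\<lambda>y. f (?t y) *\<^sub>R transition C E (?t y) v)"
      using Ck_on_compose[OF o(1) open_UNIV _ smooth_transition[OF E C(1)] f(1)]
        Ck_on_compose[OF o(1) open_chart_open[OF C(1) chart_homeomorphism(1)[OF E]] t
          smooth_transition[OF E C(1)] d]
      by (intro Ck_on_bilinear[OF bounded_bilinear_scaleR] o(1)) auto
    \<comment> \<open>The cocycle rule removes the preferred chart at \<open>q\<close>, which varies
      with \<open>q\<close> without any continuity.\<close>
    have S2: "f (?t y) *\<^sub>R transition C E (?t y) v = vf_components A E X y" if y: "y \<in> ?S" for y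
    proof -
      obtain q where q: "q \<in> fst E" "q \<in> fst C" "y = snd E q" using y by blast
      then have qy: "chart_inv E y = q" "y \<in> chart_image E"
        using chart_inv_snd[OF E] by (auto simp: chart_image_def)
      have "vf_components A E X y
          = transition (chart_at A q) E (snd (chart_at A q) q) (f (snd C q) *\<^sub>R transition C (chart_at A q) (snd C q) v)"
        by (simp only: vf_components_eq[OF E qy(2)] qy(1)) (simp add: X_def q(2))
      also have "\<dots> = f (snd C q) *\<^sub>R transition C E (snd C q) v"
        using transition_cocycle[OF C(1) chart_at(1) E q(2) chart_at(2) q(1)]
          linear_cmul[OF linear_transition[OF chart_at(1) E chart_at(2) q(1)]] by simp
      finally show ?thesis by (simp add: qy(1))
    qed
    have S: "Ck_on k ?S (vf_components A E X)"
      by (rule Ck_on_cong[OF o(1) S2 S1])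
    have T0: "vf_components A E X y = 0" if y: "y \<in> ?T" for y
    proof -
      obtain q where q: "q \<in> fst E" "q \<notin> K" "y = snd E q" using y by blast
      then have qy: "chart_inv E y = q" "y \<in> chart_image E"
        using chart_inv_snd[OF E] by (auto simp: chart_image_def)
      show ?thesis
        using linear_0[OF linear_transition[OF chart_at(1) E chart_at(2) q(1)]]
        by (simp add: vf_components_eq[OF E qy(2)] qy(1) X0[OF q(2)])
    qed
    have "Ck_on k ?T (vf_components A E X)"
      by (rule Ck_on_cong[OF o(2) T0[symmetric] Ck_on_const])
    with S show "Ck_on k (chart_image E) (vf_components A E X)"
      unfolding un using Ck_on_Un[OF o] by blast
  qed
  \<comment> \<open>\<open>C\<close> is the preferred chart at \<open>p\<close> itself, so the
    transition there is the identity.\<close>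
  moreover have "X p = v"
    using C f(2) transition_self[OF C] by (simp add: X_def C_def[symmetric])
  ultimately show ?thesis using that by blast
qed

text \<open>The description in \<open>endo_at\<close> ranges over all fields extending
  \<open>v\<close>. The hypothesis makes \<open>L v\<close> a valid value, and the existence of an
  extension makes it the only one.\<close>

lemma endo_at_eq:
  assumes "\<And>X. vector_field A X \<Longrightarrow> F X p = L (X p)"
  shows "endo_at A F p = L"
proof
  fix v
  obtain X where "vector_field A X" "X p = v" by (rule vector_field_extension)
  then show "endo_at A F p v = L v"
    unfolding endo_at_def using assms by (intro the_equality) auto
qed

end

section \<open>Skew endomorphisms\<close>

lemma linear_axis_expansion:
  assumes "linear (f :: real ^ 'n::finite \<Rightarrow> 'b::real_vector)"
  shows "(\<Sum>i\<in>UNIV. (v $ i) *\<^sub>R f (axis i 1)) = f v"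
proof -
  have "f v = f (\<Sum>i\<in>UNIV. (v $ i) *\<^sub>R axis i 1)"
    using basis_expansion[of v] by (simp add: scalar_mult_eq_scaleR)
  then show ?thesis
    by (simp add: linear_sum[OF assms] linear_cmul[OF assms])
qed

text \<open>With \<open>G\<close> the Gram matrix of \<open>b\<close> and P the matrix of
  \<open>f\<close>, skewness reads G P = - P^T G. Hence P is similar to - P^T, and its trace equals
  its own negative.\<close>

lemma trace_skew_eq_0:
  fixes f :: "real ^ 'n::finite \<Rightarrow> real ^ 'n" and b :: "real ^ 'n \<Rightarrow> real ^ 'n \<Rightarrow> real"
  assumes b: "bilinear b" and pos: "\<And>v. v \<noteq> 0 \<Longrightarrow> b v v > 0"
    and skew: "\<And>v w. b (f v) w = - b v (f w)"
  shows "trace (matrix f) = 0"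
proof -
  define G :: "real ^ 'n ^ 'n" where "G = (\<chi> i j. b (axis i 1) (axis j 1))"
  have lin: "linear (b v)" "linear (\<lambda>v. b v w)" for v w
    using b by (auto simp: bilinear_def)
  \<comment> \<open>If \<open>G *v w = 0\<close>, then \<open>w\<close> pairs to zero with every
    basis vector, hence with itself; positivity then makes \<open>G\<close> injective.\<close>
  have "w = 0" if "G *v w = 0" for w
  proof -
    have "b (axis i 1) w = (G *v w) $ i" for i
      using linear_axis_expansion[OF lin(1), of w "axis i 1"]
      by (simp add: G_def matrix_vector_mult_def mult.commute)
    then have "b (axis i 1) w = 0" for i
      using that by simp
    then have "b w w = 0"
      using linear_axis_expansion[OF lin(2), of w w] by simp
    then show ?thesis using pos[of w] by force
  qed
  then obtain B where B: "B ** G = mat 1"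
    using matrix_left_invertible_ker[of G] by blast
  then have GB: "G ** B = mat 1" by (simp add: matrix_left_right_inverse)
  let ?P = "matrix f"
  have P: "G ** ?P = - (transpose ?P ** G)"
  proof -
    have "(G ** ?P) $ i $ j = b (axis i 1) (f (axis j 1))" for i j
      using linear_axis_expansion[OF lin(1), of "f (axis j 1)" "axis i 1"]
      by (simp add: G_def matrix_matrix_mult_def matrix_def mult.commute)
    moreover have "(transpose ?P ** G) $ i $ j = b (f (axis i 1)) (axis j 1)" for i j
      using linear_axis_expansion[OF lin(2), of "f (axis i 1)" "axis j 1"]
      by (simp add: G_def matrix_matrix_mult_def matrix_def transpose_def)
    ultimately show ?thesis by (simp add: vec_eq_iff skew)
  qed
  have neg: "B ** (- M) = - (B ** M)" "trace (- M) = - trace M" for M :: "real ^ 'n ^ 'n"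
    by (simp_all add: matrix_matrix_mult_def trace_def vec_eq_iff sum_negf)
  have "trace ?P = trace (B ** (G ** ?P))"
    by (simp add: matrix_mul_assoc B)
  also have "\<dots> = - trace (B ** (transpose ?P ** G))"
    by (simp add: P neg)
  also have "\<dots> = - trace (transpose ?P ** (G ** B))"
    by (subst trace_mul_sym) (simp add: matrix_mul_assoc)
  also have "\<dots> = - trace ?P"
    by (simp add: GB trace_def transpose_def)
  finally show ?thesis by simp
qed

section \<open>Kenmotsu manifolds\<close>

locale kenmotsu_generalized_symmetric =
  smooth_manifold A for A :: "('m::{t2_space, second_countable_topology}, 'n::finite) chart set" +
  fixes phi :: "('m, 'n) endo_field" and xi :: "('m, 'n) vfield" and eta :: "('m, 'n) one_form"
    and g :: "('m, 'n) two_tensor" and nabla :: "('m, 'n) conn" and alpha beta :: "'m \<Rightarrow> real"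
  assumes kenmotsu: "kenmotsu A phi xi eta g"
    and generalized: "generalized_symmetric_metric_connection A phi eta g alpha beta nabla"
begin

section \<open>Pointwise algebra of the almost contact metric structure\<close>

lemma almost_contact: "almost_contact_metric A phi xi eta g"
  using kenmotsu by (simp add: kenmotsu_def)

lemma linear_fields: "linear (eta p)" "linear (phi p)" "bilinear (g p)"
  using almost_contact
  unfolding almost_contact_metric_def smooth_one_form_def smooth_endo_field_def riemannian_metric_def
  by blast+

lemma contact_identities:
  "phi p (xi p) = 0" "eta p (xi p) = 1" "eta p (phi p v) = 0"
  "phi p (phi p v) = - v + eta p v *\<^sub>R xi p"
  "g p v (xi p) = eta p v" "g p (xi p) v = eta p v"
  "g p (phi p v) (phi p w) = g p v w - eta p v * eta p w"
  using almost_contact unfolding almost_contact_metric_def riemannian_metric_def by metis+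

lemma metric_sym: "g p v w = g p w v"
  using almost_contact unfolding almost_contact_metric_def riemannian_metric_def by blast

lemma metric_pos: "v \<noteq> 0 \<Longrightarrow> g p v v > 0"
  using almost_contact unfolding almost_contact_metric_def riemannian_metric_def by blast

lemma metric_eq_0: "g p v v = 0 \<Longrightarrow> v = 0"
  using metric_pos[of v p] by force

lemmas tensor_linear =
  linear_add[OF linear_fields(1)] linear_diff[OF linear_fields(1)] linear_cmul[OF linear_fields(1)]
  linear_neg[OF linear_fields(1)] linear_0[OF linear_fields(1)]
  linear_add[OF linear_fields(2)] linear_diff[OF linear_fields(2)] linear_cmul[OF linear_fields(2)]
  linear_neg[OF linear_fields(2)] linear_0[OF linear_fields(2)]
  bilinear_ladd[OF linear_fields(3)] bilinear_radd[OF linear_fields(3)]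
  bilinear_lsub[OF linear_fields(3)] bilinear_rsub[OF linear_fields(3)]
  bilinear_lmul[OF linear_fields(3)] bilinear_rmul[OF linear_fields(3)]
  bilinear_lneg[OF linear_fields(3)] bilinear_rneg[OF linear_fields(3)]
  bilinear_lzero[OF linear_fields(3)] bilinear_rzero[OF linear_fields(3)]

text \<open>Put \<open>phi p w\<close> for \<open>w\<close> in the compatibility of \<open>g\<close>
  with \<open>phi\<close>; the terms in \<open>eta\<close> vanish because \<open>eta\<close> kills
  the image of \<open>phi\<close>.\<close>

lemma phi_skew: "g p (phi p v) w = - g p v (phi p w)"
proof -
  have "g p (phi p v) (phi p (phi p w)) = g p v (phi p w)"
    by (subst contact_identities(7)) (simp add: contact_identities)
  then show ?thesis
    by (simp add: contact_identities tensor_linear)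
qed

lemma vf_xi: "vector_field A xi"
  using almost_contact unfolding almost_contact_metric_def by blast

lemma smooth_eta: "vector_field A X \<Longrightarrow> smooth_fun A (\<lambda>p. eta p (X p))"
  using almost_contact unfolding almost_contact_metric_def smooth_one_form_def by blast

lemma smooth_metric: "vector_field A X \<Longrightarrow> vector_field A Y \<Longrightarrow> smooth_fun A (\<lambda>p. g p (X p) (Y p))"
  using almost_contact unfolding almost_contact_metric_def riemannian_metric_def by blast

section \<open>Calculus of the generalized symmetric metric connection\<close>

lemma smooth_alpha: "smooth_fun A alpha"
  using generalized by (simp add: generalized_symmetric_metric_connection_def)

lemma connection: "metric_connection A g nabla" "linear_connection A nabla"
  using generalized by (simp_all add: generalized_symmetric_metric_connection_def metric_connection_def)

lemma vf_nabla: "vector_field A X \<Longrightarrow> vector_field A Y \<Longrightarrow> vector_field A (nabla X Y)"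
  using connection(2) by (simp add: linear_connection_def)

lemma nabla_add_right:
  "vector_field A X \<Longrightarrow> vector_field A Y \<Longrightarrow> vector_field A Z \<Longrightarrow>
    nabla X (\<lambda>p. Y p + Z p) = (\<lambda>p. nabla X Y p + nabla X Z p)"
  using connection(2) by (simp add: linear_connection_def)

lemma nabla_scale_left:
  "smooth_fun A f \<Longrightarrow> vector_field A X \<Longrightarrow> vector_field A Y \<Longrightarrow>
    nabla (\<lambda>p. f p *\<^sub>R X p) Y = (\<lambda>p. f p *\<^sub>R nabla X Y p)"
  using connection(2) by (simp add: linear_connection_def)

lemma nabla_scale_right:
  "smooth_fun A f \<Longrightarrow> vector_field A X \<Longrightarrow> vector_field A Y \<Longrightarrow>
    nabla X (\<lambda>p. f p *\<^sub>R Y p) = (\<lambda>p. vf_apply A X f p *\<^sub>R Y p + f p *\<^sub>R nabla X Y p)"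
  using connection(2) by (simp add: linear_connection_def)

lemma nabla_zero_right:
  assumes "vector_field A X" shows "nabla X (\<lambda>p. 0) = (\<lambda>p. 0)"
proof -
  have "vector_field A (\<lambda>p. 0)"
    using vector_field_scale[OF smooth_fun_const[of 0] assms] by simp
  from nabla_add_right[OF assms this this] show ?thesis
    by (simp add: fun_eq_iff)
qed

lemma nabla_uminus_left:
  "vector_field A X \<Longrightarrow> vector_field A Y \<Longrightarrow> nabla (\<lambda>p. - X p) Y = (\<lambda>p. - nabla X Y p)"
  using nabla_scale_left[OF smooth_fun_const[of "-1"]] by simp

lemma nabla_metric:
  assumes "vector_field A X" "vector_field A Y" "vector_field A Z"
  shows "vf_apply A X (\<lambda>q. g q (Y q) (Z q)) p = g p (nabla X Y p) (Z p) + g p (Y p) (nabla X Z p)"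
  using connection(1) assms unfolding metric_connection_def by blast

lemma nabla_torsion:
  assumes "vector_field A X" "vector_field A Y"
  shows "lie_bracket A X Y p = nabla X Y p - nabla Y X p
    - (alpha p *\<^sub>R (eta p (Y p) *\<^sub>R X p - eta p (X p) *\<^sub>R Y p)
      + beta p *\<^sub>R (eta p (Y p) *\<^sub>R phi p (X p) - eta p (X p) *\<^sub>R phi p (Y p)))"
proof -
  have "torsion A nabla X Y p = alpha p *\<^sub>R (eta p (Y p) *\<^sub>R X p - eta p (X p) *\<^sub>R Y p)
      + beta p *\<^sub>R (eta p (Y p) *\<^sub>R phi p (X p) - eta p (X p) *\<^sub>R phi p (Y p))"
    using generalized assms unfolding generalized_symmetric_metric_connection_def by blast
  then show ?thesis by (simp add: torsion_def algebra_simps)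
qed

text \<open>The orthogonal projection onto the kernel of \<open>eta\<close>.\<close>

definition horizontal :: "('m, 'n) vfield \<Rightarrow> ('m, 'n) vfield" where
  "horizontal X p = X p - eta p (X p) *\<^sub>R xi p"

lemma vf_horizontal: "vector_field A X \<Longrightarrow> vector_field A (horizontal X)"
  unfolding horizontal_def by (intro vector_field_diff vector_field_scale smooth_eta vf_xi)

text \<open>The difference of two metric connections is determined by the difference of their torsions,
  by the cyclic sum that yields the Koszul formula.\<close>

lemma nabla_xi:
  assumes X: "vector_field A X"
  shows "nabla X xi p = (1 + alpha p) *\<^sub>R horizontal X p"
proof -
  obtain lc where lc: "levi_civita A g lc"
    and lc_xi: "\<And>X p. vector_field A X \<Longrightarrow> lc X xi p = horizontal X p"
    using kenmotsu unfolding kenmotsu_def horizontal_def by blast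
  define D where "D = (\<lambda>X Y p. nabla X Y p - lc X Y p)"
  have vf_lc: "vector_field A (lc X Y)" if "vector_field A X" "vector_field A Y" for X Y
    using lc that by (auto simp: levi_civita_def metric_connection_def linear_connection_def)
  have vf_D: "vector_field A (D X Y)" if "vector_field A X" "vector_field A Y" for X Y
    unfolding D_def using that by (intro vector_field_diff vf_nabla vf_lc)
  have skew: "g p (D X Y p) (Z p) = - g p (Y p) (D X Z p)"
    if "vector_field A X" "vector_field A Y" "vector_field A Z" for X Y Z
  proof -
    have "vf_apply A X (\<lambda>q. g q (Y q) (Z q)) p = g p (lc X Y p) (Z p) + g p (Y p) (lc X Z p)"
      using lc that unfolding levi_civita_def metric_connection_def by blast
    with nabla_metric[OF that, of p] show ?thesis
      by (simp add: D_def tensor_linear)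
  qed
  have tors: "D X Y p = D Y X p + (alpha p *\<^sub>R (eta p (Y p) *\<^sub>R X p - eta p (X p) *\<^sub>R Y p)
      + beta p *\<^sub>R (eta p (Y p) *\<^sub>R phi p (X p) - eta p (X p) *\<^sub>R phi p (Y p)))"
    if "vector_field A X" "vector_field A Y" for X Y
  proof -
    have "torsion A lc X Y p = 0"
      using lc that unfolding levi_civita_def by blast
    with nabla_torsion[OF that, of p] show ?thesis
      by (simp add: D_def torsion_def algebra_simps)
  qed
  \<comment> \<open>Alternating torsion and skewness carries g(D_X \<xi>, Z) to its own negative.
    Each of the two swaps with \<xi> against a horizontal part contributes \<alpha> g(h X, Z), and
    the \<beta> terms cancel because \<open>phi\<close> is skew.\<close>
  have D_xi: "g p (D X xi p) (Z p) = alpha p * g p (horizontal X p) (Z p)" if Z: "vector_field A Z" for Z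
  proof -
    have 1: "g p (D X xi p) (Z p) = g p (D xi X p) (Z p)
        + alpha p * g p (horizontal X p) (Z p) + beta p * g p (phi p (X p)) (Z p)"
      by (subst tors[OF X vf_xi]) (simp add: tensor_linear contact_identities horizontal_def algebra_simps)
    have 2: "g p (D xi X p) (Z p) = - g p (X p) (D xi Z p)"
      by (rule skew[OF vf_xi X Z])
    have 3: "g p (X p) (D xi Z p) = g p (X p) (D Z xi p)
        - alpha p * g p (horizontal X p) (Z p) - beta p * g p (X p) (phi p (Z p))"
      by (subst tors[OF vf_xi Z]) (simp add: tensor_linear contact_identities horizontal_def algebra_simps)
    have 4: "g p (X p) (D Z xi p) = - eta p (D Z X p)"
      using skew[OF Z vf_xi X] by (simp add: metric_sym contact_identities)
    have 5: "eta p (D Z X p) = eta p (D X Z p)"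
      by (subst tors[OF Z X]) (simp add: tensor_linear contact_identities algebra_simps)
    have 6: "eta p (D X Z p) = - g p (D X xi p) (Z p)"
      using skew[OF X vf_xi Z] by (simp add: contact_identities)
    have 7: "g p (phi p (X p)) (Z p) = - g p (X p) (phi p (Z p))"
      by (rule phi_skew)
    show ?thesis using 1 2 3 4 5 6 by (simp add: 7)
  qed
  \<comment> \<open>The identity is tested on the very field that is to vanish, which must therefore
    be smooth.\<close>
  let ?Z = "\<lambda>p. D X xi p - alpha p *\<^sub>R horizontal X p"
  have "vector_field A ?Z"
    by (intro vector_field_diff vector_field_scale smooth_alpha vf_horizontal vf_D X vf_xi)
  from D_xi[OF this] have "g p (?Z p) (?Z p) = 0"
    by (simp add: bilinear_lsub[OF linear_fields(3), of p "D X xi p"] bilinear_lmul[OF linear_fields(3)])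
  from metric_eq_0[OF this] show ?thesis
    using lc_xi[OF X, of p] by (simp add: D_def algebra_simps)
qed

lemma nabla_xi_xi: "nabla xi xi = (\<lambda>p. 0)"
  by (simp add: fun_eq_iff nabla_xi[OF vf_xi] horizontal_def contact_identities)

text \<open>The Levi-Civita connection is torsion-free, so the bracket is a difference of two smooth
  fields; no computation in coordinates is made.\<close>

lemma vf_lie_bracket:
  assumes "vector_field A X" "vector_field A Y"
  shows "vector_field A (lie_bracket A X Y)"
proof -
  obtain lc where lc: "levi_civita A g lc"
    using kenmotsu unfolding kenmotsu_def by blast
  have vf: "vector_field A (lc X Y)" "vector_field A (lc Y X)"
    using lc assms by (auto simp: levi_civita_def metric_connection_def linear_connection_def)
  have "torsion A lc X Y p = 0" for p
    using lc assms unfolding levi_civita_def by blast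
  then have "lie_bracket A X Y = (\<lambda>p. lc X Y p - lc Y X p)"
    by (auto simp: torsion_def fun_eq_iff)
  then show ?thesis using vector_field_diff[OF vf] by simp
qed

section \<open>Curvature and Ricci tensor along \<open>xi\<close>\<close>

lemma vf_curvature:
  assumes "vector_field A X" "vector_field A Y" "vector_field A Z"
  shows "vector_field A (curvature A nabla X Y Z)"
  unfolding curvature_def using assms
  by (intro vector_field_diff vf_nabla vf_lie_bracket)

lemma curvature_swap:
  assumes "vector_field A X" "vector_field A Y" "vector_field A Z"
  shows "curvature A nabla X Y Z p = - curvature A nabla Y X Z p"
proof -
  have "lie_bracket A X Y = (\<lambda>p. - lie_bracket A Y X p)"
    by (auto simp: lie_bracket_def Let_def)
  then show ?thesis
    using nabla_uminus_left[OF vf_lie_bracket[OF assms(2,1)] assms(3)] by (simp add: curvature_def)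
qed

lemma curvature_xi_xi:
  assumes X: "vector_field A X"
  shows "curvature A nabla X xi xi p =
    - (vf_apply A xi (\<lambda>p. 1 + alpha p) p + 1 + alpha p) *\<^sub>R horizontal X p
    + ((1 + alpha p) * beta p) *\<^sub>R phi p (X p)"
proof -
  let ?a = "\<lambda>p. 1 + alpha p"
  have sa: "smooth_fun A ?a"
    by (intro smooth_fun_add smooth_fun_const smooth_alpha)
  have X_eq: "X = (\<lambda>p. horizontal X p + eta p (X p) *\<^sub>R xi p)"
    by (simp add: horizontal_def)
  \<comment> \<open>As \<xi> is parallel along itself and the connection is metric, differentiation
    along \<xi> commutes with the horizontal projection.\<close>
  have "nabla xi X p = nabla xi (horizontal X) p + vf_apply A xi (\<lambda>p. eta p (X p)) p *\<^sub>R xi p"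
    by (subst X_eq)
      (simp add: nabla_add_right nabla_scale_right nabla_xi_xi vf_xi vf_horizontal vector_field_scale
        smooth_eta X)
  moreover have "vf_apply A xi (\<lambda>p. eta p (X p)) p = eta p (nabla xi X p)"
    using nabla_metric[OF vf_xi X vf_xi, of p]
    by (simp add: nabla_xi_xi contact_identities tensor_linear)
  ultimately have hor: "nabla xi (horizontal X) p = horizontal (nabla xi X) p"
    by (simp add: horizontal_def algebra_simps)
  have "nabla X xi = (\<lambda>p. ?a p *\<^sub>R horizontal X p)"
    using nabla_xi[OF X] by auto
  then have 1: "nabla xi (nabla X xi) p
      = vf_apply A xi ?a p *\<^sub>R horizontal X p + ?a p *\<^sub>R horizontal (nabla xi X) p"
    by (simp add: nabla_scale_right[OF sa vf_xi vf_horizontal[OF X]] hor)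
  have 2: "nabla X (nabla xi xi) p = 0"
    by (simp add: nabla_xi_xi nabla_zero_right[OF X])
  \<comment> \<open>The torsion of (X, \<xi>) is \<alpha> h X + \<beta> \<phi> X. Its first term
    cancels the \<alpha> h X contained in the derivative of \<xi> along X.\<close>
  have 3: "nabla (lie_bracket A X xi) xi p
      = ?a p *\<^sub>R (horizontal X p - horizontal (nabla xi X) p - beta p *\<^sub>R phi p (X p))"
    by (simp add: nabla_xi vf_lie_bracket X vf_xi horizontal_def nabla_torsion tensor_linear
        contact_identities algebra_simps)
  show ?thesis
    unfolding curvature_def 1 2 3 by (simp add: algebra_simps)
qed

text \<open>The map v \<mapsto> \<eta>(v) \<xi> has trace \<eta>(\<xi>) = 1, so the horizontal
  projection has trace n - 1, while the skew map \<phi> has trace zero.\<close>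

lemma ricci_xi_xi:
  "ricci A nabla xi xi p = - (real CARD('n) - 1) * (vf_apply A xi (\<lambda>p. 1 + alpha p) p + 1 + alpha p)"
proof -
  define c d where "c = vf_apply A xi (\<lambda>p. 1 + alpha p) p + 1 + alpha p"
    and "d = (1 + alpha p) * beta p"
  let ?L = "\<lambda>v. - c *\<^sub>R (v - eta p v *\<^sub>R xi p) + d *\<^sub>R phi p v"
  have "endo_at A (\<lambda>X. curvature A nabla X xi xi) p = ?L"
    by (rule endo_at_eq) (simp add: curvature_xi_xi c_def d_def horizontal_def)
  then have "ricci A nabla xi xi p = trace (matrix ?L)"
    by (simp only: ricci_def)
  also have "\<dots> = - c * real CARD('n)
      + c * (\<Sum>i\<in>UNIV. (xi p $ i) *\<^sub>R eta p (axis i 1)) + d * trace (matrix (phi p))"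
    by (simp add: trace_def matrix_def sum.distrib sum_subtractf sum_distrib_left algebra_simps
        axis_def)
  also have "(\<Sum>i\<in>UNIV. (xi p $ i) *\<^sub>R eta p (axis i 1)) = 1"
    by (simp only: linear_axis_expansion[OF linear_fields(1)] contact_identities)
  also have "trace (matrix (phi p)) = 0"
    by (rule trace_skew_eq_0[of "g p"]) (fact linear_fields metric_pos phi_skew)+
  finally show ?thesis
    unfolding c_def[symmetric] by (simp add: algebra_simps)
qed

section \<open>Ricci solitons and the steady case\<close>

lemma ricci_soliton_ricci:
  assumes "ricci_soliton A g nabla xi eta lam" "vector_field A X" "vector_field A Y"
  shows "ricci A nabla X Y p = - (1 + alpha p) * g p (horizontal X p) (Y p) - lam * g p (X p) (Y p)"
proof -
  have "lie_metric g nabla xi X Y p + 2 * ricci A nabla X Y p + 2 * lam * g p (X p) (Y p) = 0"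
    using assms by (simp add: ricci_soliton_def eta_ricci_soliton_def)
  \<comment> \<open>The horizontal projection is self-adjoint, so both terms of the Lie derivative
    agree.\<close>
  moreover have "lie_metric g nabla xi X Y p = 2 * ((1 + alpha p) * g p (horizontal X p) (Y p))"
    using assms(2,3)
    by (simp add: lie_metric_def nabla_xi horizontal_def tensor_linear contact_identities algebra_simps)
  ultimately show ?thesis by linarith
qed

text \<open>The soliton equation exhibits a smooth field representing the Ricci tensor. Any other
  one agrees with it, by testing against their difference.\<close>

lemma steady_ricci_operator:
  assumes "ricci_soliton A g nabla xi eta 0" "vector_field A X"
  shows "ricci_operator A g nabla X = (\<lambda>p. - (1 + alpha p) *\<^sub>R horizontal X p)" (is "_ = ?V")
  unfolding ricci_operator_def
proof (rule the_equality)
  have vf: "vector_field A ?V"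
    by (intro vector_field_scale vf_horizontal smooth_fun_minus smooth_fun_add smooth_fun_const
        smooth_alpha assms(2))
  have ric: "g p (?V p) (Y p) = ricci A nabla X Y p" if "vector_field A Y" for Y p
    using ricci_soliton_ricci[OF assms that] by (simp add: tensor_linear)
  show "vector_field A ?V \<and> (\<forall>Y. vector_field A Y \<longrightarrow> (\<forall>p. g p (?V p) (Y p) = ricci A nabla X Y p))"
    using vf ric by blast
  fix V
  assume V: "vector_field A V \<and> (\<forall>Y. vector_field A Y \<longrightarrow> (\<forall>p. g p (V p) (Y p) = ricci A nabla X Y p))"
  show "V = ?V"
  proof
    fix p
    have Z: "vector_field A (\<lambda>p. V p - ?V p)"
      using V vf by (intro vector_field_diff) auto
    have "g p (V p) (V p - ?V p) = g p (?V p) (V p - ?V p)"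
      unfolding ric[OF Z] using V[THEN conjunct2, rule_format, OF Z] .
    then have "g p (V p - ?V p) (V p - ?V p) = 0"
      by (simp only: bilinear_lsub[OF linear_fields(3), of p "V p"] diff_self)
    then show "V p = ?V p" using metric_eq_0[of p "V p - ?V p"] by simp
  qed
qed

text \<open>The horizontal part of a vector vanishes only on the line of \<open>xi p\<close>, which
  is a proper subspace in dimension greater than 1.\<close>

lemma horizontal_nonzero:
  assumes "CARD('n) > 1"
  obtains X where "vector_field A X" "horizontal X p \<noteq> 0"
proof -
  have "\<exists>v. v \<notin> span {xi p}"
  proof (rule ccontr)
    assume "\<not> ?thesis"
    then have "span {xi p} = UNIV" by blast
    then have "dim (UNIV :: (real ^ 'n) set) \<le> 1"
      using dim_le_card[of "UNIV :: (real ^ 'n) set" "{xi p}"] by simp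
    then show False using assms by simp
  qed
  then obtain v where v: "v \<notin> span {xi p}" by blast
  obtain X where X: "vector_field A X" "X p = v" by (rule vector_field_extension)
  have "horizontal X p \<noteq> 0"
    using v X(2) by (metis eq_iff_diff_eq_0 horizontal_def singletonI span_base span_scale)
  with X(1) show ?thesis using that by blast
qed

lemma not_steady:
  assumes "CARD('n) > 1" "alpha \<noteq> (\<lambda>p. - 1)"
    and W2: "\<And>X Y Z p. vector_field A X \<Longrightarrow> vector_field A Y \<Longrightarrow> vector_field A Z \<Longrightarrow>
      ricci A nabla (W2_curvature A g nabla xi X Y) Z p
      + ricci A nabla Y (W2_curvature A g nabla xi X Z) p = 0"
  shows "\<not> ricci_soliton A g nabla xi eta 0"
proof
  assume sol: "ricci_soliton A g nabla xi eta 0"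
  \<comment> \<open>The hypothesis on \<open>alpha\<close> yields a single point with \<alpha>
    \<noteq> -1; the contradiction is reached there.\<close>
  obtain p where p: "alpha p \<noteq> - 1" using assms(2) by auto
  obtain X where X: "vector_field A X" "horizontal X p \<noteq> 0"
    using horizontal_nonzero[OF assms(1)] by blast
  note ric = ricci_soliton_ricci[OF sol]
  let ?n = "real CARD('n) - 1" and ?h = "horizontal X p"
  have n: "?n > 0" using assms(1) by simp
  \<comment> \<open>The soliton equation applies to smooth fields only; smoothness of the Ricci
    operator comes from its explicit form.\<close>
  have vf_W: "vector_field A (W2_curvature A g nabla xi X Y)" if "vector_field A Y" for Y
    unfolding W2_curvature_def steady_ricci_operator[OF sol X(1)] steady_ricci_operator[OF sol vf_xi]
    by (intro vector_field_add vector_field_diff vector_field_scale smooth_fun_const smooth_fun_add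
        smooth_fun_minus smooth_metric smooth_alpha vf_curvature vf_horizontal vf_xi X(1) that)
  have "ricci A nabla xi xi p = 0"
    by (simp add: ric vf_xi horizontal_def contact_identities tensor_linear)
  then have c: "vf_apply A xi (\<lambda>p. 1 + alpha p) p + 1 + alpha p = 0"
    using n by (simp add: ricci_xi_xi)
  \<comment> \<open>Here g(\<xi>, \<xi>) = 1 and the Ricci operator kills \<xi>, so only its value
    at X survives; \<open>c\<close> removes the derivative of \<alpha> from the curvature.\<close>
  have W: "W2_curvature A g nabla xi X xi p
      = - ((1 + alpha p) * beta p) *\<^sub>R phi p (X p) - ((1 + alpha p) / ?n) *\<^sub>R ?h"
    by (simp add: W2_curvature_def steady_ricci_operator[OF sol] X(1) vf_xi
        curvature_swap[OF vf_xi X(1) vf_xi] curvature_xi_xi c contact_identities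
        horizontal_def[of xi])
      (simp add: divide_inverse algebra_simps)
  \<comment> \<open>Horizontal parts are orthogonal to \<xi>, so this term vanishes whatever the
    first argument is.\<close>
  have "ricci A nabla (W2_curvature A g nabla xi X X) xi p = 0"
    by (simp add: ric vf_W X(1) vf_xi horizontal_def contact_identities tensor_linear)
  with W2[OF X(1) X(1) vf_xi, of p] have "ricci A nabla X (W2_curvature A g nabla xi X xi) p = 0"
    by simp
  then have "g p ?h (W2_curvature A g nabla xi X xi p) = 0"
    using p by (simp add: ric vf_W X(1) vf_xi)
  \<comment> \<open>Skewness of \<phi> and symmetry of g give g(X, \<phi> X) = 0, and \<phi> X is
    orthogonal to \<xi>.\<close>
  moreover have "g p ?h (phi p (X p)) = 0"
    using phi_skew[of p "X p" "X p"] metric_sym[of p "X p" "phi p (X p)"]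
    by (simp add: horizontal_def tensor_linear contact_identities)
  ultimately have "(1 + alpha p) / ?n * g p ?h ?h = 0"
    unfolding W bilinear_rsub[OF linear_fields(3)] bilinear_rmul[OF linear_fields(3)] by simp
  then show False
    using p n X(2) metric_eq_0 by auto
qed

end

theorem corollary9p2:
  fixes A :: "('m::{t2_space, second_countable_topology}, 'n::finite) chart set"
    and phi :: "('m, 'n) endo_field"
    and xi :: "('m, 'n) vfield"
    and eta :: "('m, 'n) one_form"
    and g :: "('m, 'n) two_tensor"
    and nabla_bar :: "('m, 'n) conn"
    and alpha beta :: "'m \<Rightarrow> real"
    and lam :: real
  assumes "kenmotsu A phi xi eta g"
    and "CARD('n) > 1"
    and "generalized_symmetric_metric_connection A phi eta g alpha beta nabla_bar"
    and "alpha \<noteq> (\<lambda>p. - 1)"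
    and "\<And>X Y Z p. vector_field A X \<Longrightarrow> vector_field A Y \<Longrightarrow> vector_field A Z \<Longrightarrow>
           ricci A nabla_bar (W2_curvature A g nabla_bar xi X Y) Z p
           + ricci A nabla_bar Y (W2_curvature A g nabla_bar xi X Z) p = 0"
    and "ricci_soliton A g nabla_bar xi eta lam"
  shows "shrinking lam \<or> expanding lam"
proof -
  interpret kenmotsu_generalized_symmetric A phi xi eta g nabla_bar alpha beta
    using assms(1,3)
    by unfold_locales (auto simp: kenmotsu_def almost_contact_metric_def)
  have "lam \<noteq> 0"
    using not_steady[OF assms(2,4,5)] assms(6) by auto
  then show ?thesis
    by (auto simp: shrinking_def expanding_def)
qed

end
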